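(* Let $a\in(0,1)$ be irrational. Then $c_{a,0}$ starts with arbitrarily long cubes, i.e. for every $m\in\mathbb{N}$ there is $n>m$ such that $c_{a,0}(j)=c_{a,0}(j+n)$ for all $1\le j<1+2n$ (so $c_{a,0}(1)\cdots c_{a,0}(3n)=y^3$ for a word $y$ of length $n$), if and only if the continued fraction expansion of $a$ is not eventually constant equal to $1$.
   Context: For irrational $\alpha$ the characteristic Sturmian word of slope $\alpha$ is $c_{\alpha,0}=c_{\alpha,0}(1)c_{\alpha,0}(2)\cdots$ with $c_{\alpha,0}(n)=\lfloor\alpha(n+1)\rfloor-\lfloor\alpha n\rfloor-\lfloor\alpha\rfloor$. *)

theory Defs
  imports Complex_Main
begin

text \<open>An infinite word is a function on \<^typ>\<open>nat\<close> whose letters are its values at the positions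
  \<open>1, 2, \<dots>\<close>; the value at \<open>0\<close> is not part of the word.\<close>

definition char_sturmian :: "real \<Rightarrow> nat \<Rightarrow> int" where
  "char_sturmian \<alpha> n = \<lfloor>\<alpha> * (real n + 1)\<rfloor> - \<lfloor>\<alpha> * real n\<rfloor> - \<lfloor>\<alpha>\<rfloor>"

definition starts_with_cube :: "(nat \<Rightarrow> 'a) \<Rightarrow> nat \<Rightarrow> bool" where
  "starts_with_cube w n \<longleftrightarrow> (\<forall>j. 1 \<le> j \<and> j < 1 + 2 * n \<longrightarrow> w j = w (j + n))"

definition starts_with_arbitrarily_long_cubes :: "(nat \<Rightarrow> 'a) \<Rightarrow> bool" where
  "starts_with_arbitrarily_long_cubes w \<longleftrightarrow> (\<forall>m. \<exists>n>m. starts_with_cube w n)"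

lemma starts_with_cube_iff_word_cube:
  "starts_with_cube w n \<longleftrightarrow> (\<exists>y. length y = n \<and> map w [1..<1 + 3 * n] = y @ y @ y)"
proof
  assume w: "starts_with_cube w n"
  have step: "w (Suc k) = w (Suc (k + n))" if "k < 2 * n" for k
    using w that unfolding starts_with_cube_def by (auto dest: spec[of _ "Suc k"])
  define y where "y = map w [1..<1 + n]"
  have "map w [1..<1 + 3 * n] ! i = (y @ y @ y) ! i" if i: "i < 3 * n" for i
    using i step[of "i - n"] step[of "i - n - n"]
    by (auto simp: y_def nth_append not_less simp del: upt_Suc)
  hence "map w [1..<1 + 3 * n] = y @ y @ y"
    by (intro nth_equalityI) (auto simp: y_def simp del: upt_Suc)
  thus "\<exists>y. length y = n \<and> map w [1..<1 + 3 * n] = y @ y @ y"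
    by (intro exI[of _ y]) (simp add: y_def)
next
  assume "\<exists>y. length y = n \<and> map w [1..<1 + 3 * n] = y @ y @ y"
  then obtain y where y: "length y = n" "map w [1..<1 + 3 * n] = y @ y @ y" by blast
  have nth: "w (Suc i) = (y @ y @ y) ! i" if "i < 3 * n" for i
    using arg_cong[OF y(2), of "\<lambda>xs. xs ! i"] that by (simp del: upt_Suc)
  have "w j = w (j + n)" if "1 \<le> j" "j < 1 + 2 * n" for j
    using nth[of "j - 1"] nth[of "j - 1 + n"] that y(1) by (auto simp: nth_append)
  thus "starts_with_cube w n"
    by (simp add: starts_with_cube_def)
qed

text \<open>Complete quotients and partial quotients of the regular continued fraction
  \<open>[a\<^sub>0; a\<^sub>1, a\<^sub>2, \<dots>]\<close> of \<open>x\<close>. For irrational \<open>x\<close> no division by zero occurs, so the expansion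
  is infinite; for rational \<open>x\<close> the values after termination are meaningless.\<close>

primrec cf_complete :: "real \<Rightarrow> nat \<Rightarrow> real" where
  "cf_complete x 0 = x"
| "cf_complete x (Suc k) = 1 / frac (cf_complete x k)"

definition cf_quotient :: "real \<Rightarrow> nat \<Rightarrow> int" where
  "cf_quotient x k = \<lfloor>cf_complete x k\<rfloor>"

end

theory Submission
  imports Defs
begin

text \<open>Let \<open>p\<^sub>k / q\<^sub>k\<close> be the convergents of \<open>a\<close>. The word starts with a cube of period \<open>n\<close> iff
  for some integer \<open>p\<close>, putting \<open>\<delta> = n a - p\<close>, no \<open>j a\<close> with \<open>1 \<le> j \<le> 2 n + 1\<close> is
  closer than \<open>|\<delta>|\<close> to an integer on the side opposite to \<open>\<delta>\<close>. By the best approximation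
  property of convergents, \<open>n = q\<^sub>k\<close> has this property as soon as \<open>2 q\<^sub>k + 1 < q\<^sub>k\<^sub>+\<^sub>1\<close>, which
  holds whenever the \<open>(k+1)\<close>-st partial quotient is at least 2 and \<open>q\<^sub>k\<^sub>-\<^sub>1 \<ge> 2\<close>. If instead the
  partial quotients are eventually 1 and \<open>q\<^sub>k \<le> n < q\<^sub>k\<^sub>+\<^sub>1\<close>, then \<open>q\<^sub>k\<close> and \<open>q\<^sub>k\<^sub>+\<^sub>1\<close> are
  both at most \<open>2 n\<close>, approximate at least as well as \<open>n\<close> and from different sides, so one of
  them obstructs the cube.\<close>

section \<open>Convergents and the growth of their denominators\<close>

fun cf_den :: "real \<Rightarrow> nat \<Rightarrow> int" where
  "cf_den x 0 = 1"
| "cf_den x (Suc 0) = cf_quotient x 1"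
| "cf_den x (Suc (Suc k)) = cf_quotient x (Suc (Suc k)) * cf_den x (Suc k) + cf_den x k"

fun cf_num :: "real \<Rightarrow> nat \<Rightarrow> int" where
  "cf_num x 0 = cf_quotient x 0"
| "cf_num x (Suc 0) = cf_quotient x 0 * cf_quotient x 1 + 1"
| "cf_num x (Suc (Suc k)) = cf_quotient x (Suc (Suc k)) * cf_num x (Suc k) + cf_num x k"

text \<open>The sign is kept because the side on which a convergent errs decides whether it
  obstructs a cube.\<close>

definition cf_error :: "real \<Rightarrow> nat \<Rightarrow> real" where
  "cf_error x k = of_int (cf_den x k) * x - of_int (cf_num x k)"

lemma cf_complete_irrational:
  assumes "x \<notin> \<rat>"
  shows "cf_complete x k \<notin> \<rat>"
proof (induction k)
  case (Suc k)
  show ?case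
  proof
    assume "cf_complete x (Suc k) \<in> \<rat>"
    then have "1 / cf_complete x (Suc k) \<in> \<rat>"
      by (intro Rats_divide) auto
    then have "frac (cf_complete x k) + of_int \<lfloor>cf_complete x k\<rfloor> \<in> \<rat>"
      by (intro Rats_add) auto
    with Suc show False
      by (simp add: frac_def)
  qed
qed (use assms in simp)

lemma frac_cf_complete_pos:
  assumes "x \<notin> \<rat>"
  shows "0 < frac (cf_complete x k)"
  using cf_complete_irrational[OF assms, of k] Ints_subset_Rats by (auto simp: frac_gt_0_iff)

lemma cf_quotient_Suc_ge_1:
  assumes "x \<notin> \<rat>"
  shows "1 \<le> cf_quotient x (Suc k)"
  using frac_cf_complete_pos[OF assms, of k] frac_lt_1[of "cf_complete x k"]
  by (simp add: cf_quotient_def le_floor_iff)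

lemma cf_den_pos:
  assumes "x \<notin> \<rat>"
  shows "0 < cf_den x k"
proof (induction k rule: cf_den.induct[of "\<lambda>_ k. 0 < cf_den x k" x])
  case (3 y k)
  then show ?case
    using cf_quotient_Suc_ge_1[OF assms, of "Suc k"]
    by (simp add: add_pos_pos)
qed (use cf_quotient_Suc_ge_1[OF assms, of 0] in auto)

lemma cf_den_Suc_Suc_ge:
  assumes "x \<notin> \<rat>"
  shows "cf_den x (Suc k) + cf_den x k \<le> cf_den x (Suc (Suc k))"
  using mult_right_mono[OF cf_quotient_Suc_ge_1[OF assms, of "Suc k"], of "cf_den x (Suc k)"]
    cf_den_pos[OF assms, of "Suc k"] by simp

lemma cf_den_Suc_ge:
  assumes "x \<notin> \<rat>"
  shows "cf_den x k \<le> cf_den x (Suc k)"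
proof (cases k)
  case 0
  then show ?thesis using cf_quotient_Suc_ge_1[OF assms, of 0] by simp
next
  case (Suc i)
  then show ?thesis
    using cf_den_Suc_Suc_ge[OF assms, of i] cf_den_pos[OF assms, of i] by simp
qed

lemma mono_cf_den:
  assumes "x \<notin> \<rat>"
  shows "mono (cf_den x)"
  using cf_den_Suc_ge[OF assms] by (rule incseq_SucI)

text \<open>Growth is strict only from index 1 on: \<open>cf_den x 1\<close> may still equal
  1.\<close>

lemma cf_den_ge_index:
  assumes "x \<notin> \<rat>"
  shows "int k \<le> cf_den x k"
proof (induction k)
  case (Suc k)
  then show ?case
  proof (cases k)
    case 0
    then show ?thesis using cf_quotient_Suc_ge_1[OF assms, of 0] by simp
  next
    case (Suc i)
    then show ?thesis
      using Suc.IH cf_den_Suc_Suc_ge[OF assms, of i] cf_den_pos[OF assms, of i]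
      by (simp del: cf_den.simps)
  qed
qed simp

lemma cf_num_den_determinant:
  "cf_num x (Suc k) * cf_den x k - cf_num x k * cf_den x (Suc k) = (- 1) ^ k"
  by (induction k) (simp_all add: algebra_simps)

text \<open>The errors satisfy the same two-term recurrence as numerators and denominators. This one
  ratio yields that they never vanish, alternate in sign and shrink.\<close>

lemma cf_error_Suc:
  assumes "x \<notin> \<rat>"
  shows "cf_error x (Suc k) = - frac (cf_complete x (Suc k)) * cf_error x k"
proof (induction k)
  case 0
  show ?case
    using frac_cf_complete_pos[OF assms, of 0]
    by (simp add: cf_error_def cf_quotient_def frac_def field_simps)
next
  case (Suc k)
  define t where "t = frac (cf_complete x (Suc k))"
  have t: "t > 0" unfolding t_def by (rule frac_cf_complete_pos[OF assms])
  have q: "of_int (cf_quotient x (Suc (Suc k))) = 1 / t - frac (cf_complete x (Suc (Suc k)))"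
    by (simp add: cf_quotient_def frac_def t_def)
  have "cf_error x (Suc (Suc k)) =
      of_int (cf_quotient x (Suc (Suc k))) * cf_error x (Suc k) + cf_error x k"
    by (simp add: cf_error_def algebra_simps)
  \<comment> \<open>The induction hypothesis solved for the older error; its 1/t cancels the 1/t in
    \<open>q\<close>.\<close>
  also have "cf_error x k = - (1 / t) * cf_error x (Suc k)"
    using Suc t by (simp add: t_def)
  finally show ?case
    unfolding q by (simp add: algebra_simps)
qed

lemma cf_error_nonzero:
  assumes "x \<notin> \<rat>"
  shows "cf_error x k \<noteq> 0"
proof (induction k)
  case 0
  show ?case
    using frac_cf_complete_pos[OF assms, of 0]
    by (simp add: cf_error_def cf_quotient_def frac_def)
next
  case (Suc k)
  then show ?case
    using frac_cf_complete_pos[OF assms, of "Suc k"] by (simp add: cf_error_Suc[OF assms])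
qed

lemma cf_error_alternating:
  assumes "x \<notin> \<rat>"
  shows "cf_error x (Suc k) * cf_error x k < 0"
proof -
  have "0 < frac (cf_complete x (Suc k)) * (cf_error x k)\<^sup>2"
    using frac_cf_complete_pos[OF assms, of "Suc k"] cf_error_nonzero[OF assms, of k]
    by (intro mult_pos_pos) auto
  then show ?thesis
    by (simp add: cf_error_Suc[OF assms] power2_eq_square mult.assoc del: cf_complete.simps)
qed

lemma abs_cf_error_Suc_less:
  assumes "x \<notin> \<rat>"
  shows "\<bar>cf_error x (Suc k)\<bar> < \<bar>cf_error x k\<bar>"
  using frac_cf_complete_pos[OF assms, of "Suc k"] frac_lt_1[of "cf_complete x (Suc k)"]
    cf_error_nonzero[OF assms, of k]
  by (simp add: cf_error_Suc[OF assms] abs_mult del: cf_complete.simps)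

text \<open>As the determinant is a unit, (n, p) is an integer combination, with coefficients u and
  v, of two consecutive convergents. The bounds on n keep u nonzero and u, v from having the same
  sign; since the errors alternate, the two contributions cannot cancel.\<close>

lemma cf_best_approximation:
  fixes n p :: int
  assumes x: "x \<notin> \<rat>" and n: "0 < n" "n < cf_den x (Suc k)"
  shows "\<bar>cf_error x k\<bar> \<le> \<bar>of_int n * x - of_int p\<bar>"
proof -
  define s :: int where "s = (- 1) ^ k"
  \<comment> \<open>Cramer's rule; multiplying by s replaces division by the determinant s.\<close>
  define u where "u = s * (n * cf_num x (Suc k) - p * cf_den x (Suc k))"
  define v where "v = s * (p * cf_den x k - n * cf_num x k)"
  have ss: "s * s = 1" by (simp add: s_def flip: power_mult_distrib)
  have det: "cf_num x (Suc k) * cf_den x k - cf_num x k * cf_den x (Suc k) = s"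
    by (simp add: cf_num_den_determinant s_def del: cf_num.simps cf_den.simps)
  have "u * cf_den x k + v * cf_den x (Suc k) =
      n * (s * (cf_num x (Suc k) * cf_den x k - cf_num x k * cf_den x (Suc k)))"
    by (simp add: u_def v_def algebra_simps del: cf_num.simps cf_den.simps)
  then have n_eq: "n = u * cf_den x k + v * cf_den x (Suc k)"
    by (simp add: det ss del: cf_num.simps cf_den.simps)
  have "u * cf_num x k + v * cf_num x (Suc k) =
      p * (s * (cf_num x (Suc k) * cf_den x k - cf_num x k * cf_den x (Suc k)))"
    by (simp add: u_def v_def algebra_simps del: cf_num.simps cf_den.simps)
  then have p_eq: "p = u * cf_num x k + v * cf_num x (Suc k)"
    by (simp add: det ss del: cf_num.simps cf_den.simps)
  have err: "of_int n * x - of_int p = of_int u * cf_error x k + of_int v * cf_error x (Suc k)"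
    unfolding n_eq p_eq by (simp add: cf_error_def algebra_simps del: cf_num.simps cf_den.simps)
  have d: "0 < cf_den x k" "0 < cf_den x (Suc k)" using cf_den_pos[OF x] by blast+
  have u0: "u \<noteq> 0"
  proof
    assume "u = 0"
    then have "n = v * cf_den x (Suc k)" using n_eq by simp
    moreover from this have "1 \<le> v" using n d by (simp add: zero_less_mult_iff)
    ultimately show False using n d mult_right_mono[of 1 v "cf_den x (Suc k)"] by simp
  qed
  have uv: "u * v \<le> 0"
  proof (rule ccontr)
    assume "\<not> u * v \<le> 0"
    then consider "u > 0" "v > 0" | "u < 0" "v < 0" by (auto simp: not_le zero_less_mult_iff)
    then show False
    proof cases
      case 1
      then have "0 < u * cf_den x k" "1 * cf_den x (Suc k) \<le> v * cf_den x (Suc k)"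
        using d by (auto intro: mult_right_mono)
      then show False using n n_eq by simp
    next
      case 2
      then have "u * cf_den x k < 0" "v * cf_den x (Suc k) < 0"
        using d by (auto simp: mult_less_0_iff)
      then show False using n n_eq by simp
    qed
  qed
  have "0 \<le> of_int (u * v) * (cf_error x (Suc k) * cf_error x k)"
    using uv cf_error_alternating[OF x, of k]
    by (intro mult_nonpos_nonpos) (simp_all del: of_int_mult)
  then have same_sign: "0 \<le> (of_int u * cf_error x k) * (of_int v * cf_error x (Suc k))"
    by (simp add: mult_ac)
  have "\<bar>cf_error x k\<bar> \<le> \<bar>of_int u * cf_error x k\<bar>"
    using u0 mult_right_mono[of 1 "\<bar>of_int u :: real\<bar>" "\<bar>cf_error x k\<bar>"]
    by (simp add: abs_mult)
  also have "\<dots> \<le> \<bar>of_int u * cf_error x k + of_int v * cf_error x (Suc k)\<bar>"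
    using same_sign by (auto simp: zero_le_mult_iff)
  finally show ?thesis by (simp add: err)
qed

section \<open>Cubes as shifts that cross no integer\<close>

text \<open>Letters are differences of consecutive floors, so the 2n letter equations say that
  \<open>f\<close> is constant on 1, ..., 2n+1; p is its value.\<close>

lemma starts_with_cube_char_sturmian_iff:
  "starts_with_cube (char_sturmian a) n \<longleftrightarrow>
    (\<exists>p. \<forall>j. 1 \<le> j \<and> j \<le> 2 * n + 1 \<longrightarrow>
      \<lfloor>a * real j + (a * real n - of_int p)\<rfloor> = \<lfloor>a * real j\<rfloor>)"
proof -
  define f where "f j = \<lfloor>a * real (j + n)\<rfloor> - \<lfloor>a * real j\<rfloor>" for j
  have step: "char_sturmian a j = char_sturmian a (j + n) \<longleftrightarrow> f (Suc j) = f j" for j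
    by (auto simp: char_sturmian_def f_def add_ac)
  have shift: "\<lfloor>a * real j + (a * real n - of_int p)\<rfloor> = \<lfloor>a * real j\<rfloor> \<longleftrightarrow> f j = p" for j p
  proof -
    have "a * real j + (a * real n - of_int p) = a * real (j + n) - of_int p"
      by (simp add: algebra_simps)
    then show ?thesis by (simp only: floor_diff_of_int f_def) auto
  qed
  have "starts_with_cube (char_sturmian a) n \<longleftrightarrow>
      (\<forall>j. 1 \<le> j \<and> j < 1 + 2 * n \<longrightarrow> f (Suc j) = f j)"
    by (simp add: starts_with_cube_def step)
  also have "\<dots> \<longleftrightarrow> (\<exists>p. \<forall>j. 1 \<le> j \<and> j \<le> 2 * n + 1 \<longrightarrow> f j = p)"
  proof
    assume *: "\<forall>j. 1 \<le> j \<and> j < 1 + 2 * n \<longrightarrow> f (Suc j) = f j"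
    have "f j = f 1" if "1 \<le> j" "j \<le> 2 * n + 1" for j
      using that by (induction j rule: dec_induct) (use * in auto)
    then show "\<exists>p. \<forall>j. 1 \<le> j \<and> j \<le> 2 * n + 1 \<longrightarrow> f j = p" by blast
  next
    assume "\<exists>p. \<forall>j. 1 \<le> j \<and> j \<le> 2 * n + 1 \<longrightarrow> f j = p"
    then obtain p where "\<And>j. 1 \<le> j \<Longrightarrow> j \<le> 2 * n + 1 \<Longrightarrow> f j = p" by blast
    then show "\<forall>j. 1 \<le> j \<and> j < 1 + 2 * n \<longrightarrow> f (Suc j) = f j" by simp
  qed
  finally show ?thesis by (simp add: shift)
qed

lemma irrational_mult_nat_neq_int:
  assumes "a \<notin> \<rat>" "0 < n"
  shows "a * real n \<noteq> of_int q"
proof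
  assume "a * real n = of_int q"
  then have "a = of_int q / of_nat n" using assms(2) by (simp add: field_simps)
  with assms(1) show False by simp
qed

lemma starts_with_cube_cf_den:
  assumes a: "a \<notin> \<rat>" and gap: "2 * cf_den a k + 1 < cf_den a (Suc k)"
  shows "starts_with_cube (char_sturmian a) (nat (cf_den a k))"
proof -
  define n where "n = nat (cf_den a k)"
  have n: "int n = cf_den a k" using cf_den_pos[OF a, of k] by (simp add: n_def)
  then have rn: "real n = of_int (cf_den a k)" by (metis of_int_of_nat_eq)
  have err: "a * real n - of_int (cf_num a k) = cf_error a k"
    by (simp add: cf_error_def rn mult.commute)
  have "\<lfloor>a * real j + cf_error a k\<rfloor> = \<lfloor>a * real j\<rfloor>" if j: "1 \<le> j" "j \<le> 2 * n + 1" for j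
  proof -
    have best: "\<bar>cf_error a k\<bar> \<le> \<bar>a * real j - of_int q\<bar>" for q
      using cf_best_approximation[OF a, of "int j" k q] j gap n by (simp add: mult.commute)
    \<comment> \<open>\<open>best\<close> is not strict, so landing exactly on the next integer must
      be excluded separately.\<close>
    have ne: "a * real j + cf_error a k \<noteq> of_int q" for q
    proof
      assume "a * real j + cf_error a k = of_int q"
      then have "a * real (j + n) = of_int (q + cf_num a k)"
        by (simp add: err[symmetric] algebra_simps)
      then show False
        using irrational_mult_nat_neq_int[OF a, of "j + n" "q + cf_num a k"] j by simp
    qed
    show ?thesis
      using best[of "\<lfloor>a * real j\<rfloor>"] best[of "\<lfloor>a * real j\<rfloor> + 1"]
        ne[of "\<lfloor>a * real j\<rfloor> + 1"] floor_correct[of "a * real j"]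
      by (intro floor_unique) (auto simp: abs_if split: if_splits)
  qed
  then show ?thesis
    unfolding starts_with_cube_char_sturmian_iff n_def[symmetric] err[symmetric] by blast
qed

lemma no_cube_between_cf_dens:
  assumes a: "a \<notin> \<rat>" and n: "cf_den a k \<le> int n" "int n < cf_den a (Suc k)"
    and close: "cf_den a (Suc k) \<le> 2 * cf_den a k"
  shows "\<not> starts_with_cube (char_sturmian a) n"
proof
  assume "starts_with_cube (char_sturmian a) n"
  then obtain p where p: "\<And>j. 1 \<le> j \<Longrightarrow> j \<le> 2 * n + 1 \<Longrightarrow>
      \<lfloor>a * real j + (a * real n - of_int p)\<rfloor> = \<lfloor>a * real j\<rfloor>"
    unfolding starts_with_cube_char_sturmian_iff by blast
  define \<delta> where "\<delta> = a * real n - of_int p"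
  have "n > 0" using n cf_den_pos[OF a, of k] by simp
  have \<delta>0: "\<delta> \<noteq> 0"
    using irrational_mult_nat_neq_int[OF a \<open>n > 0\<close>, of p] by (simp add: \<delta>_def)
  have best: "\<bar>cf_error a k\<bar> \<le> \<bar>\<delta>\<bar>"
    using cf_best_approximation[OF a, of "int n" k p] n \<open>n > 0\<close> by (simp add: \<delta>_def mult.commute)
  \<comment> \<open>Otherwise, at j = q_i, adding \<delta> to the smaller error of opposite sign
    carries it across 0 and changes the floor.\<close>
  have obstruct: "\<bar>\<delta>\<bar> \<le> \<bar>cf_error a i\<bar>"
    if i: "cf_den a i \<le> 2 * int n + 1" and opp: "cf_error a i * \<delta> < 0" for i
  proof (rule ccontr)
    assume less: "\<not> \<bar>\<delta>\<bar> \<le> \<bar>cf_error a i\<bar>"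
    define j where "j = nat (cf_den a i)"
    have j: "int j = cf_den a i" using cf_den_pos[OF a, of i] by (simp add: j_def)
    then have rj: "real j = of_int (cf_den a i)" by (metis of_int_of_nat_eq)
    have err: "a * real j = of_int (cf_num a i) + cf_error a i"
      by (simp add: cf_error_def rj mult.commute)
    have "1 \<le> j" "j \<le> 2 * n + 1" using i j cf_den_pos[OF a, of i] by linarith+
    from p[OF this] have "\<lfloor>cf_error a i + \<delta>\<rfloor> = \<lfloor>cf_error a i\<rfloor>"
      by (simp add: err add.assoc flip: \<delta>_def)
    moreover have "\<lfloor>cf_error a i + \<delta>\<rfloor> < 0 \<longleftrightarrow> \<not> \<lfloor>cf_error a i\<rfloor> < 0"
      using less opp by (auto simp: mult_less_0_iff)
    ultimately show False by simp
  qed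
  show False
  proof (cases "cf_error a k * \<delta> < 0")
    case True
    \<comment> \<open>Only exact cancellation remains, which would make a nonzero multiple of a an
      integer.\<close>
    then have "\<bar>\<delta>\<bar> = \<bar>cf_error a k\<bar>" using obstruct[of k] best n by simp
    then have "\<delta> = - cf_error a k" using True by (auto simp: abs_eq_iff mult_less_0_iff)
    then have "a * real (n + nat (cf_den a k)) = of_int (p + cf_num a k)"
      using cf_den_pos[OF a, of k] by (simp add: \<delta>_def cf_error_def algebra_simps)
    then show False
      using irrational_mult_nat_neq_int[OF a, of "n + nat (cf_den a k)" "p + cf_num a k"] \<open>n > 0\<close>
      by simp
  next
    case False
    then have "0 < cf_error a k * \<delta>" using \<delta>0 cf_error_nonzero[OF a, of k]
      by (simp add: not_less order_less_le)
    then have "cf_error a (Suc k) * \<delta> < 0"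
      using cf_error_alternating[OF a, of k] by (auto simp: mult_less_0_iff zero_less_mult_iff)
    then have "\<bar>\<delta>\<bar> \<le> \<bar>cf_error a (Suc k)\<bar>" using close n by (intro obstruct) auto
    then show False using best abs_cf_error_Suc_less[OF a, of k] by simp
  qed
qed

section \<open>Cubes versus partial quotients\<close>

theorem theorem7p5:
  fixes a :: real
  assumes "a \<in> {0<..<1}" and "a \<notin> \<rat>"
  shows "starts_with_arbitrarily_long_cubes (char_sturmian a) \<longleftrightarrow>
    \<not> (\<exists>N. \<forall>k\<ge>N. cf_quotient a k = 1)"
proof
  note a = assms(2)
  show "\<not> (\<exists>N. \<forall>k\<ge>N. cf_quotient a k = 1)"
    if cubes: "starts_with_arbitrarily_long_cubes (char_sturmian a)"
  proof
    assume "\<exists>N. \<forall>k\<ge>N. cf_quotient a k = 1"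
    then obtain N where N: "\<And>k. k \<ge> N \<Longrightarrow> cf_quotient a k = 1" by blast
    from cubes obtain n where n: "n > nat (cf_den a (Suc N))"
      and cube: "starts_with_cube (char_sturmian a) n"
      unfolding starts_with_arbitrarily_long_cubes_def by blast
    have "int n < cf_den a (Suc n)" using cf_den_ge_index[OF a, of "Suc n"] by simp
    \<comment> \<open>Minimality will place n between q_k and q_(k+1), once k is known to be
      positive.\<close>
    define k where "k = (LEAST k. int n < cf_den a (Suc k))"
    have k: "int n < cf_den a (Suc k)"
      unfolding k_def by (rule LeastI) fact
    have "Suc N \<le> k"
    proof (rule ccontr)
      assume "\<not> Suc N \<le> k"
      then have "cf_den a (Suc k) \<le> cf_den a (Suc N)" by (intro monoD[OF mono_cf_den[OF a]]) simp
      then show False using k n by linarith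
    qed
    then obtain i where i: "k = Suc i" "N \<le> i" by (cases k) auto
    have "cf_den a k \<le> int n"
      using not_less_Least[of i "\<lambda>k. int n < cf_den a (Suc k)"] i by (simp flip: k_def)
    \<comment> \<open>The partial quotient is 1 here, so q_(k+1) = q_k + q_(k-1).\<close>
    moreover have "cf_den a (Suc k) \<le> 2 * cf_den a k"
      using N[of "Suc (Suc i)"] i cf_den_Suc_ge[OF a, of i] by simp
    ultimately show False using no_cube_between_cf_dens[OF a _ k] cube by blast
  qed
  show "starts_with_arbitrarily_long_cubes (char_sturmian a)"
    if nonconst: "\<not> (\<exists>N. \<forall>k\<ge>N. cf_quotient a k = 1)"
    unfolding starts_with_arbitrarily_long_cubes_def
  proof
    fix m
    \<comment> \<open>The margin 4 leaves i >= m + 2: then q_i >= 2 makes the gap condition strict,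
      and q_(i+1) exceeds m.\<close>
    from nonconst obtain k where k: "k \<ge> m + 4" "cf_quotient a k \<noteq> 1" by blast
    then obtain i where i: "k = Suc (Suc i)" "m + 2 \<le> i"
      using that[of "k - 2"] by simp
    have "2 \<le> cf_quotient a k"
      using k cf_quotient_Suc_ge_1[OF a, of "Suc i"] i by simp
    then have "2 * cf_den a (Suc i) \<le> cf_quotient a k * cf_den a (Suc i)"
      using cf_den_pos[OF a, of "Suc i"] by (intro mult_right_mono) auto
    then have "2 * cf_den a (Suc i) + 1 < cf_den a (Suc (Suc i))"
      using cf_den_ge_index[OF a, of i] i by simp
    then have "starts_with_cube (char_sturmian a) (nat (cf_den a (Suc i)))"
      by (rule starts_with_cube_cf_den[OF a])
    moreover have "m < nat (cf_den a (Suc i))"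
      using cf_den_ge_index[OF a, of "Suc i"] i by linarith
    ultimately show "\<exists>n>m. starts_with_cube (char_sturmian a) n" by blast
  qed
qed

end
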